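(* Let $\mathfrak g$ be a real Lie algebra with a flat, torsion-free connection $\nabla$ and a parallel complex structure $J$ (i.e. $\nabla J=0$). Then the tangent algebra $T_\nabla\mathfrak g$ carries a hypercomplex structure whose Obata connection is $\nabla^1$, where $\nabla^1_{(x,y)}(z,w)=(\nabla_xz,\nabla_xw)$.
   Context: Lie algebras are finite-dimensional over $\mathbb R$. A complex structure on a real Lie algebra $\mathfrak g$ is an endomorphism $J$ with $J^2=-1$ and $J[x,y]-[Jx,y]-[x,Jy]-J[Jx,Jy]=0$ for all $x,y\in\mathfrak g$. A hypercomplex structure is a pair $\{J_1,J_2\}$ of anticommuting complex structures. A connection on $\mathfrak g$ is a linear map $\nabla:\mathfrak g\to\mathfrak{gl}(\mathfrak g)$, $x\mapsto\nabla_x$. It is flat if $\nabla_{[x,y]}=[\nabla_x,\nabla_y]$, torsion-free if $\nabla_xy-\nabla_yx=[x,y]$, and $\nabla J=0$ means $\nabla_xJ=J\nabla_x$ for all $x$. The Obata connection of a hypercomplex structure $\{J_1,J_2\}$ is the unique torsion-free connection with $\nabla J_1=\nabla J_2=0$. For a flat connection $\nabla$, the tangent algebra $T_\nabla\mathfrak g$ is the vector space $\mathfrak g\oplus\mathfrak g$ with bracket $[(x,u),(y,v)]=([x,y],\nabla_xv-\nabla_yu)$. *)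

theory Defs
  imports "HOL-Analysis.Analysis"
begin

text \<open>A Lie algebra is given by its bracket on the whole of a real vector space type. The class
  real_vector is used with an explicit finiteness assumption rather than euclidean_space, so
  that no inner product is fixed and the zero algebra is included.\<close>

locale lie_algebra =
  fixes br :: "'a::real_vector \<Rightarrow> 'a \<Rightarrow> 'a"
  assumes finite_dim: "\<exists>B :: 'a set. finite B \<and> span B = UNIV"
    and br_bilinear: "bilinear br"
    and br_alternating: "br x x = 0"
    and jacobi: "br x (br y z) + br y (br z x) + br z (br x y) = 0"

locale complex_structure = lie_algebra br
  for br :: "'a::real_vector \<Rightarrow> 'a \<Rightarrow> 'a" +
  fixes J :: "'a \<Rightarrow> 'a"
  assumes J_linear: "linear J"
    and J_squared: "J (J x) = - x"
    and J_integrable: "J (br x y) - br (J x) y - br x (J y) - J (br (J x) (J y)) = 0"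

definition hypercomplex_structure ::
    "('a::real_vector \<Rightarrow> 'a \<Rightarrow> 'a) \<Rightarrow> ('a \<Rightarrow> 'a) \<Rightarrow> ('a \<Rightarrow> 'a) \<Rightarrow> bool" where
  "hypercomplex_structure br J1 J2 \<longleftrightarrow>
     complex_structure br J1 \<and> complex_structure br J2 \<and> (\<forall>x. J1 (J2 x) = - J2 (J1 x))"

text \<open>In curried form, bilinearity of \<open>D\<close> says exactly that \<open>x \<mapsto> D x\<close> is a linear map into the
  endomorphisms.\<close>

definition connection :: "('a::real_vector \<Rightarrow> 'a \<Rightarrow> 'a) \<Rightarrow> bool" where
  "connection D \<longleftrightarrow> bilinear D"

definition flat :: "('a::real_vector \<Rightarrow> 'a \<Rightarrow> 'a) \<Rightarrow> ('a \<Rightarrow> 'a \<Rightarrow> 'a) \<Rightarrow> bool" where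
  "flat br D \<longleftrightarrow> (\<forall>x y z. D (br x y) z = D x (D y z) - D y (D x z))"

definition torsion_free :: "('a::real_vector \<Rightarrow> 'a \<Rightarrow> 'a) \<Rightarrow> ('a \<Rightarrow> 'a \<Rightarrow> 'a) \<Rightarrow> bool" where
  "torsion_free br D \<longleftrightarrow> (\<forall>x y. D x y - D y x = br x y)"

definition parallel :: "('a::real_vector \<Rightarrow> 'a \<Rightarrow> 'a) \<Rightarrow> ('a \<Rightarrow> 'a) \<Rightarrow> bool" where
  "parallel D J \<longleftrightarrow> (\<forall>x y. D x (J y) = J (D x y))"

text \<open>Uniqueness is part of the definition, so that one may speak of the Obata connection.\<close>

definition is_obata_connection ::
    "('a::real_vector \<Rightarrow> 'a \<Rightarrow> 'a) \<Rightarrow> ('a \<Rightarrow> 'a) \<Rightarrow> ('a \<Rightarrow> 'a) \<Rightarrow> ('a \<Rightarrow> 'a \<Rightarrow> 'a) \<Rightarrow> bool" where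
  "is_obata_connection br J1 J2 D \<longleftrightarrow>
     (connection D \<and> torsion_free br D \<and> parallel D J1 \<and> parallel D J2) \<and>
     (\<forall>D'. connection D' \<and> torsion_free br D' \<and> parallel D' J1 \<and> parallel D' J2 \<longrightarrow> D' = D)"

definition tangent_bracket ::
    "('a::real_vector \<Rightarrow> 'a \<Rightarrow> 'a) \<Rightarrow> ('a \<Rightarrow> 'a \<Rightarrow> 'a) \<Rightarrow> 'a \<times> 'a \<Rightarrow> 'a \<times> 'a \<Rightarrow> 'a \<times> 'a" where
  "tangent_bracket br D = (\<lambda>(x, u) (y, v). (br x y, D x v - D y u))"

definition tangent_connection ::
    "('a::real_vector \<Rightarrow> 'a \<Rightarrow> 'a) \<Rightarrow> 'a \<times> 'a \<Rightarrow> 'a \<times> 'a \<Rightarrow> 'a \<times> 'a" where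
  "tangent_connection D = (\<lambda>(x, y) (z, w). (D x z, D x w))"

end

theory Submission
  imports Defs
begin

text \<open>
  On pairs put \<open>J1 (x, u) = (J x, - J u)\<close> and \<open>J2 (x, u) = (- u, x)\<close>; the opposite signs in
  \<open>J1\<close> make it anticommute with the rotation \<open>J2\<close>. The connection \<open>tangent_connection D\<close>
  applies the same endomorphism \<open>D x\<close> to both components, and \<open>D x\<close> commutes with \<open>J\<close>, so both
  structures are parallel. The tangent bracket is the antisymmetrization of this connection because
  \<open>D\<close> is torsion-free; it satisfies the Jacobi identity because \<open>D\<close> is flat.

  Integrability and uniqueness then come from two general facts: an almost complex structure that is
  parallel for some torsion-free connection is integrable (\<open>integrable_if_parallel\<close>), and
  torsion-free connections preserving the same anticommuting pair coincide
  (\<open>torsion_free_parallel_unique\<close>).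
\<close>

text \<open>The integrability expression becomes a combination of covariant derivatives once every
  bracket is replaced by \<open>D x y - D y x\<close>; since \<open>J\<close> passes through \<open>D x\<close> and squares to \<open>-1\<close>,
  these derivatives cancel in pairs.\<close>

lemma integrable_if_parallel:
  assumes "linear J" and sq: "\<And>x. J (J x) = - x"
    and tf: "torsion_free br D" and par: "parallel D J"
  shows "J (br x y) - br (J x) y - br x (J y) - J (br (J x) (J y)) = 0"
proof -
  have br: "br a b = D a b - D b a" for a b
    using tf by (simp add: torsion_free_def)
  have "D a (J b) = J (D a b)" for a b
    using par by (simp add: parallel_def)
  then show ?thesis
    by (simp add: br linear_diff[OF \<open>linear J\<close>] sq)
qed

text \<open>The difference \<open>S\<close> of the two connections is symmetric, because both have the same torsion,
  and commutes with \<open>J1\<close> and \<open>J2\<close> in each argument. Pulling \<open>J1\<close> and \<open>J2\<close> out of \<open>S (J1 x) (J2 y)\<close>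
  in the two possible orders gives \<open>J1 (J2 (S x y)) = J2 (J1 (S x y))\<close>, so by anticommutation
  \<open>2 J1 (J2 (S x y)) = 0\<close>, and \<open>J1\<close>, \<open>J2\<close> are injective.\<close>

lemma torsion_free_parallel_unique:
  fixes D D' :: "'a::real_vector \<Rightarrow> 'a \<Rightarrow> 'a"
  assumes lin: "linear J1" "linear J2"
    and sq: "\<And>x. J1 (J1 x) = - x" "\<And>x. J2 (J2 x) = - x"
    and anti: "\<And>x. J1 (J2 x) = - J2 (J1 x)"
    and D: "torsion_free br D" "parallel D J1" "parallel D J2"
    and D': "torsion_free br D'" "parallel D' J1" "parallel D' J2"
  shows "D' = D"
proof (intro ext)
  fix x y
  define S where "S a b = D' a b - D a b" for a b
  have sym: "S a b = S b a" for a b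
  proof -
    have "D' a b - D' b a = D a b - D b a"
      using D(1) D'(1) by (simp add: torsion_free_def)
    then show ?thesis by (simp add: S_def algebra_simps)
  qed
  have right: "S a (J1 b) = J1 (S a b)" "S a (J2 b) = J2 (S a b)" for a b
    using D D' lin by (simp_all add: S_def parallel_def linear_diff)
  have left: "S (J1 a) b = J1 (S a b)" "S (J2 a) b = J2 (S a b)" for a b
    by (metis sym right)+
  have "J1 (J2 (S x y)) = J2 (J1 (S x y))"
    by (metis left(1) right(2))
  then have "J1 (J2 (S x y)) = - J1 (J2 (S x y))"
    by (simp add: anti)
  then have "2 *\<^sub>R J1 (J2 (S x y)) = 0"
    by (simp add: scaleR_2 eq_neg_iff_add_eq_0)
  then have "J1 (J2 (S x y)) = 0"
    by simp
  then have "J1 (J1 (J2 (S x y))) = J1 0" by simp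
  then have "J2 (S x y) = 0"
    by (simp add: sq linear_0[OF lin(1)])
  then have "J2 (J2 (S x y)) = J2 0" by simp
  then have "S x y = 0"
    by (simp add: sq linear_0[OF lin(2)])
  then show "D' x y = D x y"
    by (simp add: S_def)
qed

lemma finite_span_Times:
  fixes B :: "'a::real_vector set" and C :: "'b::real_vector set"
  assumes "finite B" "span B = UNIV" "finite C" "span C = UNIV"
  shows "\<exists>E :: ('a \<times> 'b) set. finite E \<and> span E = UNIV"
proof (intro exI conjI)
  let ?E = "(\<lambda>x. (x, 0)) ` B \<union> (\<lambda>y. (0, y)) ` C"
  show "finite ?E" using assms by simp
  have l: "linear (\<lambda>x::'a. (x, 0::'b))" and r: "linear (\<lambda>y::'b. (0::'a, y))"
    by (auto intro!: linearI)
  have "(x, 0) \<in> span ?E" for x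
  proof -
    have "(x, 0) \<in> span ((\<lambda>x. (x, 0::'b)) ` B)"
      using assms by (simp add: linear_span_image[OF l])
    then show ?thesis by (meson span_mono sup_ge1 subsetD)
  qed
  moreover have "(0, y) \<in> span ?E" for y
  proof -
    have "(0, y) \<in> span ((\<lambda>y. (0::'a, y)) ` C)"
      using assms by (simp add: linear_span_image[OF r])
    then show ?thesis by (meson span_mono sup_ge2 subsetD)
  qed
  ultimately have "(x, 0) + (0, y) \<in> span ?E" for x y
    by (rule span_add)
  then show "span ?E = UNIV" by auto
qed

lemma connection_tangent_connection:
  assumes "connection D"
  shows "connection (tangent_connection D)"
  using assms unfolding connection_def tangent_connection_def
  by (auto simp: bilinear_def linear_iff)

lemma torsion_free_tangent_connection:
  assumes "torsion_free br D"
  shows "torsion_free (tangent_bracket br D) (tangent_connection D)"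
  using assms by (auto simp: torsion_free_def tangent_bracket_def tangent_connection_def)

text \<open>The tangent algebra is the semidirect product of the Lie algebra with the abelian ideal of
  second components, on which it acts through \<open>D\<close>; flatness says that this is a representation.\<close>

lemma lie_algebra_tangent_bracket:
  fixes br :: "'a::real_vector \<Rightarrow> 'a \<Rightarrow> 'a"
  assumes "lie_algebra br" "connection D" "flat br D"
  shows "lie_algebra (tangent_bracket br D)"
proof -
  interpret lie_algebra br by fact
  have bil: "bilinear D" using assms(2) by (simp add: connection_def)
  have fl: "D (br x y) z = D x (D y z) - D y (D x z)" for x y z
    using assms(3) by (simp add: flat_def)
  show ?thesis
  proof
    show "\<exists>B :: ('a \<times> 'a) set. finite B \<and> span B = UNIV"
      using finite_dim finite_span_Times by blast
    show "bilinear (tangent_bracket br D)"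
      using br_bilinear bil unfolding tangent_bracket_def
      by (auto simp: bilinear_def linear_iff algebra_simps)
    show "tangent_bracket br D p p = 0" for p
      by (simp add: tangent_bracket_def br_alternating zero_prod_def split: prod.split)
    show "tangent_bracket br D p (tangent_bracket br D q r)
        + tangent_bracket br D q (tangent_bracket br D r p)
        + tangent_bracket br D r (tangent_bracket br D p q) = 0" for p q r
      by (cases p; cases q; cases r)
        (simp add: tangent_bracket_def jacobi zero_prod_def fl bilinear_rsub[OF bil])
  qed
qed

theorem corollary4p3:
  fixes br :: "'a::real_vector \<Rightarrow> 'a \<Rightarrow> 'a"
    and D :: "'a \<Rightarrow> 'a \<Rightarrow> 'a"
    and J :: "'a \<Rightarrow> 'a"
  assumes "lie_algebra br"
    and "connection D"
    and "flat br D"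
    and "torsion_free br D"
    and "complex_structure br J"
    and "parallel D J"
  shows "\<exists>J1 J2. hypercomplex_structure (tangent_bracket br D) J1 J2 \<and>
           is_obata_connection (tangent_bracket br D) J1 J2 (tangent_connection D)"
proof -
  interpret complex_structure br J by fact
  define J1 where "J1 = (\<lambda>(x, u). (J x, - J u))"
  define J2 where "J2 = (\<lambda>(x::'a, u::'a). (- u, x))"
  let ?br = "tangent_bracket br D" and ?D = "tangent_connection D"
  have bil: "bilinear D" using assms(2) by (simp add: connection_def)
  have lin: "linear J1" "linear J2"
    using J_linear by (auto simp: J1_def J2_def linear_iff)
  have sq: "\<And>p. J1 (J1 p) = - p" "\<And>p. J2 (J2 p) = - p"
    by (auto simp: J1_def J2_def J_squared linear_neg[OF J_linear])
  have anti: "J1 (J2 p) = - J2 (J1 p)" for p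
    by (cases p) (simp add: J1_def J2_def linear_neg[OF J_linear])
  have par: "parallel ?D J1" "parallel ?D J2"
    using assms(6)
    by (auto simp: parallel_def tangent_connection_def J1_def J2_def bilinear_rneg[OF bil])
  have tf: "torsion_free ?br ?D"
    by (rule torsion_free_tangent_connection) fact
  have lie: "lie_algebra ?br"
    using assms by (intro lie_algebra_tangent_bracket)
  have "complex_structure ?br J1" "complex_structure ?br J2"
    using lie lin sq integrable_if_parallel[OF lin(1) sq(1) tf par(1)]
      integrable_if_parallel[OF lin(2) sq(2) tf par(2)]
    by (auto simp: complex_structure_def complex_structure_axioms_def)
  then have "hypercomplex_structure ?br J1 J2"
    using anti by (simp add: hypercomplex_structure_def)
  moreover have "is_obata_connection ?br J1 J2 ?D"
    unfolding is_obata_connection_def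
    using connection_tangent_connection[OF assms(2)] tf par
      torsion_free_parallel_unique[OF lin sq anti tf par] by blast
  ultimately show ?thesis by blast
qed

end
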